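(* There exists a constant $c_{\#} > 0$ such that $\mathsf{m}_{\#}(A) \ge c_{\#} A^2$ for all real $A > 0$; i.e., $\mathsf{m}_{\#}(A) = \Omega(A^2)$.
   Context: Let $\varphi(t) = \frac{1}{\sqrt{2\pi}} e^{-\frac12 t^2}$ for $t \in \mathbb{R}$ be the standard Gaussian density. Consider Gaussian mixtures $f_Y(t) = \sum_{k=1}^N p_k \varphi(t-a_k)$, where $N \ge 1$ is an integer (not fixed in advance), $a_k \in [-A,A]$ for all $k$, $p_k > 0$ for all $k$, $\sum_{k=1}^N p_k = 1$, and where additionally the mixing distribution has variance at most $1$, i.e., a random variable $X$ with distribution $\sum_{k=1}^N p_k \delta_{a_k}$ satisfies $\mathrm{var}(X) = \sum_k p_k a_k^2 - \bigl(\sum_k p_k a_k\bigr)^2 \le 1$. A mode of such a density is a local maximum of it on $\mathbb{R}$. For $A > 0$, $\mathsf{m}_{\#}(A)$ denotes the maximum number of modes among all such densities $f_Y$ (over all integers $N \ge 1$, all $p_1,\ldots,p_N > 0$ with $\sum_{k=1}^N p_k = 1$, and all $a_1,\ldots,a_N \in [-A,A]$ satisfying $\sum_k p_k a_k^2 - \bigl(\sum_k p_k a_k\bigr)^2 \le 1$). The notation $g(A) = \Omega(f(A))$ means that there exists a constant $\kappa_0 > 0$ such that $g(A) \ge \kappa_0 f(A)$ for all $A > 0$. *)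

theory Defs
  imports "HOL-Probability.Probability"
begin

definition admissible :: "real \<Rightarrow> nat \<Rightarrow> (nat \<Rightarrow> real) \<Rightarrow> (nat \<Rightarrow> real) \<Rightarrow> bool" where
  "admissible A N p a \<longleftrightarrow>
     N \<ge> 1 \<and>
     (\<forall>k\<in>{1..N}. p k > 0) \<and>
     (\<Sum>k=1..N. p k) = 1 \<and>
     (\<forall>k\<in>{1..N}. a k \<in> {-A..A}) \<and>
     (\<Sum>k=1..N. p k * (a k)\<^sup>2) - (\<Sum>k=1..N. p k * a k)\<^sup>2 \<le> 1"

definition gaussian_mixture :: "nat \<Rightarrow> (nat \<Rightarrow> real) \<Rightarrow> (nat \<Rightarrow> real) \<Rightarrow> real \<Rightarrow> real" where
  "gaussian_mixture N p a t = (\<Sum>k=1..N. p k * std_normal_density (t - a k))"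

definition modes :: "(real \<Rightarrow> real) \<Rightarrow> real set" where
  "modes f = {t. \<exists>\<epsilon>>0. \<forall>s. \<bar>s - t\<bar> < \<epsilon> \<longrightarrow> f s \<le> f t}"

definition num_modes :: "(real \<Rightarrow> real) \<Rightarrow> enat" where
  "num_modes f = (if finite (modes f) then enat (card (modes f)) else \<infinity>)"

(* The maximum is written as a supremum in enat, so that the definition does not presuppose
   a uniform bound. As soon as the supremum is finite, it is attained and hence a maximum. *)
definition max_modes :: "real \<Rightarrow> enat" where
  "max_modes A = (SUP (N, p, a) \<in> {(N, p, a). admissible A N p a}.
                    num_modes (gaussian_mixture N p a))"

end

theory Submission
  imports Defs "HOL-Real_Asymp.Real_Asymp"
begin

text \<open>Put mass \<open>1 - 1/A\<^sup>2\<close> at \<open>0\<close> and spread the remaining \<open>1/A\<^sup>2\<close> uniformly over the grid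
  \<open>h, 2h, \<dots>, K h = A\<close> with \<open>h\<close> of order \<open>1/A\<close>; the variance is at most \<open>1\<close>.
  On \<open>[A/3, 2A/3]\<close> the central Gaussian is of size \<open>exp (- A\<^sup>2/18)\<close>, and shifting by \<open>h\<close> changes
  the grid sum only by two boundary terms, so the density is periodic up to an error of that order.
  Its Fourier coefficient of period \<open>h\<close> over a window of length \<open>h\<close> unfolds to the Fourier
  transform of the Gaussian at \<open>2\<pi>/h\<close>, which exceeds \<open>exp (- A\<^sup>2/72)\<close> if \<open>h \<ge> 48/A\<close>.
  Thus in each window the oscillation dominates the periodicity error, which forces a local maximum
  near it, and there are of order \<open>A\<^sup>2\<close> windows.\<close>

section \<open>Local maxima forced by oscillation\<close>

lemma mode_in_open_interval:
  fixes f :: "real \<Rightarrow> real"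
  assumes "continuous_on {a..b} f" "c \<in> {a..b}" "f a < f c" "f b < f c"
  shows "\<exists>t\<in>modes f. t \<in> {a<..<b}"
proof -
  obtain t where t: "t \<in> {a..b}" "\<And>s. s \<in> {a..b} \<Longrightarrow> f s \<le> f t"
    using continuous_attains_sup[OF compact_Icc _ assms(1)] assms(2) by fastforce
  have "f c \<le> f t" using t(2) assms(2) by blast
  hence "t \<noteq> a" "t \<noteq> b" using assms by auto
  hence ab: "a < t" "t < b" using t(1) by auto
  have "t \<in> modes f"
    unfolding modes_def
    by (rule CollectI, rule exI[of _ "min (t - a) (b - t)"]) (use ab in \<open>auto intro!: t(2) simp: abs_less_iff\<close>)
  thus ?thesis using ab by auto
qed

text \<open>As \<open>g\<close> has mean zero, \<open>f\<close> may be replaced by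
  \<open>f - f m\<close> under the integral, with \<open>f m\<close> the minimum on the window; so
  \<open>osc\<close> forces maximum minus minimum above \<open>\<eta>\<close>. Shifting the minimum
  by \<open>h\<close> costs at most \<open>\<eta>\<close> and gives a second low point on the other
  side of the maximum.\<close>

lemma mode_in_window:
  fixes f g :: "real \<Rightarrow> real"
  assumes contf: "continuous_on UNIV f" and contg: "continuous_on UNIV g"
    and "h > 0"
    and g: "\<And>t. \<bar>g t\<bar> \<le> 1" "integral {x..x+h} g = 0"
    and shift: "\<And>t. t \<in> {x-h..x+h} \<Longrightarrow> \<bar>f (t + h) - f t\<bar> \<le> \<eta>"
    and osc: "integral {x..x+h} (\<lambda>t. f t * g t) > h * \<eta>"
  shows "\<exists>t\<in>modes f. t \<in> {x-h<..<x+2*h}"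
proof -
  have ne: "{x..x+h} \<noteq> {}" using \<open>h > 0\<close> by auto
  obtain M where M: "M \<in> {x..x+h}" "\<And>s. s \<in> {x..x+h} \<Longrightarrow> f s \<le> f M"
    using continuous_attains_sup[OF compact_Icc ne] contf continuous_on_subset
    by (metis subset_UNIV)
  obtain m where m: "m \<in> {x..x+h}" "\<And>s. s \<in> {x..x+h} \<Longrightarrow> f m \<le> f s"
    using continuous_attains_inf[OF compact_Icc ne] contf continuous_on_subset
    by (metis subset_UNIV)
  note cont = continuous_on_subset[OF contf] continuous_on_subset[OF contg]
  have int: "(\<lambda>t. f t * g t) integrable_on {x..x+h}" "(\<lambda>t. f m * g t) integrable_on {x..x+h}"
    "(\<lambda>t. (f t - f m) * g t) integrable_on {x..x+h}"
    by (intro integrable_continuous_interval continuous_intros cont; simp)+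
  have "integral {x..x+h} (\<lambda>t. f t * g t)
      = integral {x..x+h} (\<lambda>t. f t * g t) - integral {x..x+h} (\<lambda>t. f m * g t)"
    using g(2) by simp
  also have "\<dots> = integral {x..x+h} (\<lambda>t. (f t - f m) * g t)"
    by (subst integral_diff[symmetric, OF int(1,2)]) (simp add: algebra_simps)
  also have "\<dots> \<le> integral {x..x+h} (\<lambda>t. f M - f m)"
  proof (rule integral_le[OF int(3)])
    fix t assume t: "t \<in> {x..x+h}"
    have "(f t - f m) * g t \<le> (f t - f m) * 1"
      using m(2)[OF t] g(1)[of t] by (intro mult_left_mono) auto
    thus "(f t - f m) * g t \<le> f M - f m" using M(2)[OF t] by simp
  qed auto
  also have "\<dots> = h * (f M - f m)" using \<open>h > 0\<close> by simp
  finally have "h * \<eta> < h * (f M - f m)" using osc by linarith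
  hence gap: "\<eta> < f M - f m" using \<open>h > 0\<close> by simp
  have "\<eta> \<ge> 0" using shift[of x] \<open>h > 0\<close> by force
  consider "M < m" | "m < M" using gap \<open>\<eta> \<ge> 0\<close> by fastforce
  thus ?thesis
  proof cases
    \<comment> \<open>Both points lie in a window of length \<open>h\<close>, so
      \<open>m - h \<le> M < m\<close>, and \<open>f (m - h) \<le> f m + \<eta> < f M\<close>. The
      other case is the mirror image.\<close>
    case 1
    have "\<bar>f m - f (m - h)\<bar> \<le> \<eta>" using shift[of "m - h"] m(1) \<open>h > 0\<close> by auto
    hence "\<exists>t\<in>modes f. t \<in> {m-h<..<m}"
      using 1 gap \<open>\<eta> \<ge> 0\<close> M(1) m(1)
      by (intro mode_in_open_interval[where c = M] cont) auto
    thus ?thesis using m(1) \<open>h > 0\<close> by force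
  next
    case 2
    have "\<bar>f (m + h) - f m\<bar> \<le> \<eta>" using shift[of "m"] m(1) \<open>h > 0\<close> by auto
    hence "\<exists>t\<in>modes f. t \<in> {m<..<m+h}"
      using 2 gap \<open>\<eta> \<ge> 0\<close> M(1) m(1)
      by (intro mode_in_open_interval[where c = M] cont) auto
    thus ?thesis using m(1) \<open>h > 0\<close> by force
  qed
qed

section \<open>Estimates and integrals for the Gaussian density\<close>

lemma continuous_on_std_normal_density [continuous_intros]:
  "continuous_on S f \<Longrightarrow> continuous_on S (\<lambda>t. std_normal_density (f t))"
  unfolding std_normal_density_def by (intro continuous_intros) auto

lemma std_normal_density_tail:
  assumes "0 \<le> B" "B \<le> \<bar>t\<bar>"
  shows "std_normal_density t \<le> exp (- B\<^sup>2 / 2)"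
proof -
  have "1 / sqrt (2 * pi) \<le> 1" using pi_gt3 by simp
  moreover have "B\<^sup>2 \<le> t\<^sup>2" using assms by (metis abs_of_nonneg abs_le_square_iff)
  ultimately have "1 / sqrt (2 * pi) * exp (- t\<^sup>2 / 2) \<le> 1 * exp (- B\<^sup>2 / 2)"
    by (intro mult_mono) auto
  thus ?thesis by (simp add: std_normal_density_def)
qed

text \<open>This is the real part of the characteristic function of the standard normal
  distribution.\<close>

lemma has_bochner_integral_std_normal_density_cos:
  "has_bochner_integral lborel (\<lambda>t. std_normal_density t * cos (w * t)) (exp (- w\<^sup>2 / 2))"
proof -
  interpret real_distribution std_normal_distribution by (rule real_dist_normal_dist)
  have int: "integrable lborel (\<lambda>t. std_normal_density t * cos (w * t))"
    by (rule Bochner_Integration.integrable_bound[OF integrable_normal_density[of 1 0]])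
       (auto simp: abs_mult mult_left_le)
  have i: "integrable std_normal_distribution (\<lambda>x. iexp (w * x))"
    using integrable_iexp[of "\<lambda>x. complex_of_real (w * x)"] by simp
  have "exp (- w\<^sup>2 / 2) = Re (char std_normal_distribution w)"
    by (simp add: char_std_normal_distribution)
  also have "\<dots> = (LINT x|std_normal_distribution. Re (iexp (w * x)))"
    unfolding char_def by (rule integral_Re[OF i, symmetric])
  also have "\<dots> = (LINT x|lborel. std_normal_density x * cos (w * x))"
    by (subst integral_density) (auto simp: Re_exp)
  finally show ?thesis using int by (simp add: has_bochner_integral_iff)
qed

text \<open>The full integral is the Fourier transform \<open>exp (- w\<^sup>2 / 2)\<close>. For the
  part cut off, half of the exponent \<open>t\<^sup>2 / 2\<close> supplies the factor
  \<open>exp (- B\<^sup>2 / 4)\<close>; the other half leaves \<open>sqrt 2\<close> times the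
  density of variance 2, which integrates to 1.\<close>

lemma std_normal_density_cos_integral_ge:
  assumes "0 \<le> B" "a \<le> - B" "B \<le> b"
  shows "exp (- w\<^sup>2 / 2) - sqrt 2 * exp (- B\<^sup>2 / 4)
           \<le> integral {a..b} (\<lambda>t. std_normal_density t * cos (w * t))"
proof -
  let ?f = "\<lambda>t. std_normal_density t * cos (w * t)"
  let ?N = "normal_density 0 (sqrt 2)"
  have f: "integrable lborel ?f" "(LINT t|lborel. ?f t) = exp (- w\<^sup>2 / 2)"
    using has_bochner_integral_std_normal_density_cos[of w] by (auto simp: has_bochner_integral_iff)
  have si: "set_integrable lborel {a..b} ?f"
    unfolding set_integrable_def using f(1) by (intro integrable_mult_indicator) auto
  hence si': "integrable lborel (\<lambda>t. indicator {a..b} t * ?f t)" by (simp add: set_integrable_def)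
  have N: "integrable lborel (\<lambda>t. sqrt 2 * exp (- B\<^sup>2 / 4) * ?N t)"
    by (intro integrable_mult_right integrable_normal_density) simp
  have "(LINT t|lborel. ?f t) - integral {a..b} ?f
      = (LINT t|lborel. ?f t - indicator {a..b} t * ?f t)"
    using set_borel_integral_eq_integral(2)[OF si] Bochner_Integration.integral_diff[OF f(1) si']
    by (simp add: set_lebesgue_integral_def)
  also have "\<dots> \<le> (LINT t|lborel. sqrt 2 * exp (- B\<^sup>2 / 4) * ?N t)"
  proof (rule integral_mono[OF Bochner_Integration.integrable_diff[OF f(1) si'] N])
    fix t :: real
    show "?f t - indicator {a..b} t * ?f t \<le> sqrt 2 * exp (- B\<^sup>2 / 4) * ?N t"
    proof (cases "t \<in> {a..b}")
      case False
      hence "B \<le> \<bar>t\<bar>" using assms by auto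
      hence "B\<^sup>2 \<le> t\<^sup>2" using assms by (metis abs_of_nonneg abs_le_square_iff)
      hence "exp (- t\<^sup>2 / 2) \<le> exp (- B\<^sup>2 / 4) * exp (- t\<^sup>2 / 4)"
        by (simp add: exp_add[symmetric])
      hence "std_normal_density t \<le> 1 / sqrt (2 * pi) * (exp (- B\<^sup>2 / 4) * exp (- t\<^sup>2 / 4))"
        unfolding std_normal_density_def by (intro mult_left_mono) auto
      also have "\<dots> = sqrt 2 * exp (- B\<^sup>2 / 4) * ?N t"
        by (simp add: normal_density_def real_sqrt_mult field_simps)
      finally have "std_normal_density t \<le> sqrt 2 * exp (- B\<^sup>2 / 4) * ?N t" .
      moreover have "?f t \<le> std_normal_density t" by (simp add: mult_left_le)
      ultimately show ?thesis using False by simp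
    qed simp
  qed
  also have "\<dots> = sqrt 2 * exp (- B\<^sup>2 / 4)"
  proof -
    have "(LINT t|lborel. ?N t) = 1" by (rule integral_normal_density) simp
    thus ?thesis by simp
  qed
  finally show ?thesis using f(2) by linarith
qed

text \<open>The shifts by multiples of the period turn the window integrals of the summands into
  integrals over adjacent intervals.\<close>

lemma window_integral_std_normal_density_comb:
  fixes h x :: real and K :: nat
  assumes "h > 0"
  defines "g \<equiv> \<lambda>t. cos (2 * pi / h * t)"
  shows "integral {x..x+h} (\<lambda>t. (\<Sum>k=1..K. std_normal_density (t - real k * h)) * g t)
           = integral {x - real K * h..x} (\<lambda>t. std_normal_density t * g t)"
proof (induction K)
  case (Suc K)
  let ?c = "real (Suc K) * h"
  let ?f = "\<lambda>t. std_normal_density t * g t"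
  have cont: "continuous_on S g" for S unfolding g_def by (intro continuous_intros)
  have per: "g (t - ?c) = g t" for t
  proof -
    have "2 * pi / h * (t - ?c) = 2 * pi / h * t - 2 * pi * real (Suc K)"
      using \<open>h > 0\<close> by (simp add: field_simps)
    thus ?thesis
      unfolding g_def by (simp add: cos_diff cos_integer_2pi sin_integer_2pi del: of_nat_Suc)
  qed
  have "integral {x..x+h} (\<lambda>t. std_normal_density (t - ?c) * g t)
      = integral {x..x+h} (\<lambda>t. ?f (t + - ?c))" using per by simp
  also have "\<dots> = integral {x - ?c..x + h - ?c} ?f"
    using integral_shift_real_ivl[of "x - ?c" "-?c" "x + h - ?c" ?f] by simp
  finally have shift: "integral {x..x+h} (\<lambda>t. std_normal_density (t - ?c) * g t)
      = integral {x - ?c..x - real K * h} ?f" by (simp add: algebra_simps)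
  have "integral {x..x+h} (\<lambda>t. (\<Sum>k=1..Suc K. std_normal_density (t - real k * h)) * g t)
      = integral {x..x+h} (\<lambda>t. (\<Sum>k=1..K. std_normal_density (t - real k * h)) * g t
                              + std_normal_density (t - ?c) * g t)"
    by (simp add: distrib_right)
  also have "\<dots> = integral {x - real K * h..x} ?f + integral {x - ?c..x - real K * h} ?f"
    unfolding Suc.IH[symmetric] shift[symmetric]
    by (intro integral_add integrable_continuous_interval continuous_intros cont)
  also have "\<dots> = integral {x - ?c..x} ?f"
  proof -
    have "?f integrable_on {x - ?c..x}"
      by (intro integrable_continuous_interval continuous_intros cont)
    thus ?thesis
      using \<open>h > 0\<close> Henstock_Kurzweil_Integration.integral_combine[where a = "x - ?c" and c = "x - real K * h" and b = x and f = ?f]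
      by (simp add: algebra_simps)
  qed
  finally show ?case .
qed simp

lemma integral_cos_period:
  fixes h x :: real
  assumes "h > 0"
  shows "integral {x..x+h} (\<lambda>t. cos (2 * pi / h * t)) = 0"
proof -
  have "((\<lambda>t. cos (2 * pi / h * t)) has_integral
      (h / (2 * pi) * sin (2 * pi / h * (x + h)) - h / (2 * pi) * sin (2 * pi / h * x))) {x..x+h}"
    using assms
    by (intro fundamental_theorem_of_calculus)
       (auto simp flip: has_real_derivative_iff_has_vector_derivative
             intro!: derivative_eq_intros)
  moreover have "2 * pi / h * (x + h) = 2 * pi / h * x + 2 * pi"
    using assms by (simp add: field_simps)
  ultimately show ?thesis by (simp add: integral_unique)
qed


section \<open>From windows to a count of modes\<close>

lemma max_modes_ge:
  assumes adm: "admissible A N p a" and "finite I"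
    and W: "disjoint_family_on W I"
    and ex: "\<And>i. i \<in> I \<Longrightarrow> \<exists>t\<in>modes (gaussian_mixture N p a). t \<in> W i"
  shows "enat (card I) \<le> max_modes A"
proof -
  let ?f = "gaussian_mixture N p a"
  obtain m where m: "\<And>i. i \<in> I \<Longrightarrow> m i \<in> modes ?f" "\<And>i. i \<in> I \<Longrightarrow> m i \<in> W i"
    using ex by metis
  have "inj_on m I"
  proof (rule inj_onI)
    fix i j assume "i \<in> I" "j \<in> I" "m i = m j"
    thus "i = j" using W m(2)[of i] m(2)[of j] by (auto simp: disjoint_family_on_def)
  qed
  \<comment> \<open>Only the finite case needs the injection; otherwise \<open>num_modes\<close> is
    \<open>\<infinity>\<close>.\<close>
  hence "card I \<le> card (modes ?f)" if "finite (modes ?f)"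
    using that m(1) by (intro card_inj_on_le[of m]) auto
  hence "enat (card I) \<le> num_modes ?f" by (simp add: num_modes_def)
  also have "\<dots> \<le> max_modes A"
    unfolding max_modes_def using adm by (intro SUP_upper2[of "(N, p, a)"]) auto
  finally show ?thesis .
qed

text \<open>A single Gaussian settles bounded \<open>A\<close>, where \<open>c * A\<^sup>2\<close>
  can be kept below 1.\<close>

lemma max_modes_ge_1:
  assumes "A > 0"
  shows "1 \<le> max_modes A"
proof -
  have "admissible A 1 (\<lambda>_. 1) (\<lambda>_. 0)" using assms by (simp add: admissible_def)
  moreover have "0 \<in> modes (gaussian_mixture 1 (\<lambda>_. 1) (\<lambda>_. 0))"
    by (auto simp: modes_def gaussian_mixture_def std_normal_density_def
             intro!: exI[of _ 1] divide_right_mono)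
  ultimately have "enat (card {0::nat}) \<le> max_modes A"
    by (intro max_modes_ge[where W = "\<lambda>_. UNIV"]) (auto simp: disjoint_family_on_def)
  thus ?thesis by (simp add: one_enat_def)
qed

section \<open>The mixture of a central atom and a fine grid\<close>

text \<open>\<open>nA\<close> makes the grid step \<open>A / (9 * n)\<close> at least
  \<open>48 / A\<close>. In \<open>large\<close>, the right side bounds the Fourier coefficient from
  below; on the left stand the truncation error and the contribution of the boundary terms and the
  central Gaussian.\<close>

lemma max_modes_ge_of_large:
  fixes A :: real and n :: nat
  assumes "A > 1" "n > 0" and nA: "432 * real n \<le> A\<^sup>2"
    and large: "sqrt 2 * exp (- A\<^sup>2 / 36) + 2 * A ^ 3 * exp (- A\<^sup>2 / 18) < exp (- A\<^sup>2 / 72)"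
  shows "enat n \<le> max_modes A"
proof -
  \<comment> \<open>With \<open>K = 9 * n\<close> the middle third of \<open>[0, A]\<close> has
    length \<open>3 * n * h\<close>: room for \<open>n\<close> intervals of length
    \<open>3 * h\<close>.\<close>
  define K where "K = 9 * n"
  define h where "h = A / real K"
  define \<epsilon> where "\<epsilon> = 1 / A\<^sup>2"
  define \<eta> where "\<eta> = exp (- A\<^sup>2 / 18)"
  define g where "g = (\<lambda>t. cos (2 * pi / h * t))"
  define S where "S = (\<lambda>t. \<Sum>k=1..K. std_normal_density (t - real k * h))"
  define p where "p = (\<lambda>k. if k \<le> K then \<epsilon> / real K else 1 - \<epsilon>)"
  define a where "a = (\<lambda>k. if k \<le> K then real k * h else 0)"
  define f where "f = gaussian_mixture (Suc K) p a"
  \<comment> \<open>The intervals from \<open>x i - h\<close> to \<open>x i + 2 * h\<close> given by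
    \<open>mode_in_window\<close> then tile the middle third, from \<open>3 * n * h = A / 3\<close>
    to \<open>6 * n * h = 2 * A / 3\<close>; the \<open>+ 1\<close> leaves room for the
    \<open>h\<close> on the left.\<close>
  define x where "x = (\<lambda>i. (3 * real n + 1 + 3 * real i) * h)"
  have K: "K > 0" "real K = 9 * real n" using \<open>n > 0\<close> by (auto simp: K_def)
  have h: "h > 0" "real K * h = A" using K \<open>A > 1\<close> by (auto simp: h_def)
  have hn: "real n * h = A / 9" using h(2) K(2) by simp
  have \<epsilon>: "0 < \<epsilon>" "\<epsilon> < 1" "\<epsilon> * A\<^sup>2 = 1" using \<open>A > 1\<close> by (auto simp: \<epsilon>_def)

  have adm: "admissible A (Suc K) p a"
    unfolding admissible_def
  proof (intro conjI ballI)
    show "p k > 0" for k using \<epsilon> K by (auto simp: p_def)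
    have "(\<Sum>k=1..K. p k) = \<epsilon>" using K by (simp add: p_def)
    thus "(\<Sum>k=1..Suc K. p k) = 1" by (simp add: p_def)
    have ah: "0 \<le> a k \<and> a k \<le> A" for k
    proof (cases "k \<le> K")
      case True
      hence "real k * h \<le> real K * h" using h(1) by (intro mult_right_mono) auto
      thus ?thesis using True h by (simp add: a_def)
    qed (use \<open>A > 1\<close> in \<open>auto simp: a_def\<close>)
    thus "a k \<in> {- A..A}" for k using ah[of k] \<open>A > 1\<close> by (simp add: order_trans[of "- A" 0])
    \<comment> \<open>The second moment alone is at most \<open>\<epsilon> * A\<^sup>2 = 1\<close>,
      and the variance is no larger.\<close>
    have "(\<Sum>k=1..K. p k * (a k)\<^sup>2) \<le> (\<Sum>k=1..K. \<epsilon> / real K * A\<^sup>2)"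
      using \<epsilon> ah by (intro sum_mono mult_mono power_mono) (auto simp: p_def)
    also have "\<dots> = 1" using \<epsilon>(3) K(1) by simp
    finally have "(\<Sum>k=1..Suc K. p k * (a k)\<^sup>2) \<le> 1" by (simp add: a_def)
    thus "(\<Sum>k=1..Suc K. p k * (a k)\<^sup>2) - (\<Sum>k=1..Suc K. p k * a k)\<^sup>2 \<le> 1"
      by (smt (verit) zero_le_power2)
  qed simp

  have f_eq: "f t = \<epsilon> / real K * S t + (1 - \<epsilon>) * std_normal_density t" for t
    by (simp add: f_def gaussian_mixture_def p_def a_def S_def sum_distrib_left)
  have contS: "continuous_on X S" for X
    unfolding S_def by (intro continuous_intros)
  have contg: "continuous_on X g" for X
    unfolding g_def by (intro continuous_intros)
  have contf: "continuous_on X f" for X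
    unfolding f_eq by (intro continuous_intros contS)

  have eta: "0 \<le> std_normal_density t" "std_normal_density t \<le> \<eta>" if "A / 3 \<le> \<bar>t\<bar>" for t
    using std_normal_density_tail[of "A / 3" t] that \<open>A > 1\<close>
    by (auto simp: \<eta>_def power_divide)

  have S_shift: "S (t + h) - S t = std_normal_density t - std_normal_density (t - A)" for t
  proof -
    let ?u = "\<lambda>k. std_normal_density (t - real k * h)"
    \<comment> \<open>Shifting by \<open>h\<close> turns index \<open>k\<close> into
      \<open>k - 1\<close>, so the sum telescopes; as \<open>k\<close> starts at 1, the subtraction
      is not truncated.\<close>
    have "S (t + h) - S t = (\<Sum>k=1..K. ?u (k - 1) - ?u k)"
      unfolding S_def sum_subtractf[symmetric]
      by (intro sum.cong) (auto simp: of_nat_diff algebra_simps)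
    also have "\<dots> = ?u 0 - ?u K" by (induction K) auto
    finally show ?thesis by (simp add: h(2))
  qed

  have osc: "exp (- A\<^sup>2 / 72) - sqrt 2 * exp (- A\<^sup>2 / 36)
      \<le> integral {x i - A..x i} (\<lambda>t. std_normal_density t * g t)" if "i < n" for i
  proof -
    \<comment> \<open>The interval of integration contains \<open>[- A / 3, A / 3]\<close>, so the
      truncated Fourier bound applies with \<open>B = A / 3\<close>.\<close>
    have "x i = A / 3 + (1 + 3 * real i) * h" using hn by (simp add: x_def algebra_simps)
    hence lo: "A / 3 \<le> x i" using h(1) by simp
    have "(3 * real n + 1 + 3 * real i) * h \<le> (6 * real n) * h"
      using that h(1) by (intro mult_right_mono) auto
    hence "x i - A \<le> - (A / 3)" using hn by (simp add: x_def)
    moreover have "0 \<le> A / 3" using \<open>A > 1\<close> by simp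
    ultimately have bound: "exp (- (2 * pi / h)\<^sup>2 / 2) - sqrt 2 * exp (- (A / 3)\<^sup>2 / 4)
        \<le> integral {x i - A..x i} (\<lambda>t. std_normal_density t * cos (2 * pi / h * t))"
      using lo by (intro std_normal_density_cos_integral_ge)
    have "(2 * pi / h)\<^sup>2 / 2 \<le> A\<^sup>2 / 72"
    proof -
      \<comment> \<open>Here 432 pays off: \<open>2 * pi / h = 18 * pi * n / A\<close>, and
        \<open>pi < 4\<close> brings this below \<open>A / 6\<close>.\<close>
      have "pi * (432 * real n) \<le> 4 * A\<^sup>2" using pi_less_4 nA by (intro mult_mono) auto
      hence "2 * pi * (9 * real n) / A \<le> A / 6"
        using \<open>A > 1\<close> by (simp add: field_simps power2_eq_square)
      hence "(2 * pi / h)\<^sup>2 \<le> (A / 6)\<^sup>2"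
        using \<open>A > 1\<close> h(1) K by (intro power_mono) (auto simp: h_def)
      thus ?thesis by (simp add: power_divide)
    qed
    hence "exp (- A\<^sup>2 / 72) \<le> exp (- (2 * pi / h)\<^sup>2 / 2)" by simp
    moreover have "- (A / 3)\<^sup>2 / 4 = - A\<^sup>2 / 36" by (simp add: power_divide)
    ultimately show ?thesis
      using bound unfolding g_def by (simp only:)
  qed

  have mode: "\<exists>t\<in>modes f. t \<in> {x i - h<..<x i + 2 * h}" if "i < n" for i
  proof (rule mode_in_window[where \<eta> = \<eta>, OF contf contg h(1)])
    have "3 * real n * h \<le> (3 * real n + 3 * real i) * h"
      using h(1) by (intro mult_right_mono) auto
    hence lo: "A / 3 \<le> x i - h" using hn by (simp add: x_def algebra_simps)
    have "(3 * real n + 3 * real i + 3) * h \<le> (6 * real n) * h"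
      using that h(1) by (intro mult_right_mono) auto
    hence hi: "x i + 2 * h \<le> 2 * A / 3" using hn by (simp add: x_def algebra_simps)
    show "\<bar>g t\<bar> \<le> 1" for t by (simp add: g_def)
    show "integral {x i..x i + h} g = 0" unfolding g_def by (rule integral_cos_period[OF h(1)])
    show "\<bar>f (t + h) - f t\<bar> \<le> \<eta>" if t: "t \<in> {x i - h..x i + h}" for t
    proof -
      \<comment> \<open>\<open>t\<close> and \<open>t + h\<close> stay in the middle third, at
        distance at least \<open>A / 3\<close> from both 0 and \<open>A\<close>, so every Gaussian
        involved is at most \<open>\<eta>\<close>.\<close>
      have "\<bar>t\<bar> \<ge> A / 3" "\<bar>t + h\<bar> \<ge> A / 3" "\<bar>t - A\<bar> \<ge> A / 3"
        using t lo hi h(1) \<open>A > 1\<close> by auto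
      note b = eta[OF this(1)] eta[OF this(2)] eta[OF this(3)]
      have d: "\<bar>std_normal_density t - std_normal_density (t - A)\<bar> \<le> \<eta>"
        "\<bar>std_normal_density (t + h) - std_normal_density t\<bar> \<le> \<eta>"
        using b by linarith+
      have "f (t + h) - f t = \<epsilon> / real K * (S (t + h) - S t)
          + (1 - \<epsilon>) * (std_normal_density (t + h) - std_normal_density t)"
        by (simp add: f_eq algebra_simps)
      also have "\<bar>\<dots>\<bar> \<le> \<epsilon> / real K * \<eta> + (1 - \<epsilon>) * \<eta>"
        unfolding S_shift using d \<epsilon>
        by (intro order_trans[OF abs_triangle_ineq] add_mono)
           (auto simp: abs_mult simp del: times_divide_eq_left intro!: mult_left_mono)
      also have "\<dots> \<le> \<epsilon> * \<eta> + (1 - \<epsilon>) * \<eta>"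
        using \<epsilon> K(1) by (intro add_right_mono mult_right_mono) (auto simp: \<eta>_def field_simps)
      finally show ?thesis by (simp add: algebra_simps)
    qed
    let ?\<phi> = "\<lambda>t. std_normal_density t * g t"
    have int: "(\<lambda>t. S t * g t) integrable_on {x i..x i + h}" "?\<phi> integrable_on {x i..x i + h}"
      by (intro integrable_continuous_interval continuous_intros contS contg)+
    \<comment> \<open>The central Gaussian may work against the oscillation, but by at most
      \<open>h * \<eta>\<close>.\<close>
    have "- (h * \<eta>) = integral {x i..x i + h} (\<lambda>t. - \<eta>)" using h(1) by simp
    also have "\<dots> \<le> integral {x i..x i + h} ?\<phi>"
    proof (rule integral_le)
      fix t assume "t \<in> {x i..x i + h}"
      hence "\<bar>t\<bar> \<ge> A / 3" using lo h(1) by auto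
      note b = eta[OF this]
      have "\<bar>?\<phi> t\<bar> \<le> \<eta> * 1"
        unfolding abs_mult using b by (intro mult_mono) (auto simp: g_def \<eta>_def)
      thus "- \<eta> \<le> ?\<phi> t" by linarith
    qed (use int in auto)
    finally have center: "- (h * \<eta>) \<le> integral {x i..x i + h} ?\<phi>" .
    \<comment> \<open>The factor \<open>2 * A ^ 3\<close> becomes \<open>2 * (h * \<eta>)\<close>
      after weighting by \<open>\<epsilon> / real K\<close>: one share absorbs the central Gaussian,
      the other is the required lower bound.\<close>
    have "2 * A ^ 3 * \<eta> < integral {x i - A..x i} ?\<phi>"
      using osc[OF that] large by (simp add: \<eta>_def)
    hence "\<epsilon> / real K * (2 * A ^ 3 * \<eta>) < \<epsilon> / real K * integral {x i - A..x i} ?\<phi>"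
      using \<epsilon> K(1) by (intro mult_strict_left_mono) auto
    moreover have "\<epsilon> / real K * (2 * A ^ 3 * \<eta>) = 2 * (h * \<eta>)"
      using \<open>A > 1\<close> by (simp add: \<epsilon>_def h_def power2_eq_square power3_eq_cube)
    moreover have "(1 - \<epsilon>) * - (h * \<eta>) \<le> (1 - \<epsilon>) * integral {x i..x i + h} ?\<phi>"
      using center \<epsilon> by (intro mult_left_mono) auto
    moreover have "\<epsilon> * (h * \<eta>) \<ge> 0" using \<epsilon> h(1) by (simp add: \<eta>_def)
    moreover have "integral {x i..x i + h} (\<lambda>t. f t * g t)
        = \<epsilon> / real K * integral {x i..x i + h} (\<lambda>t. S t * g t)
          + (1 - \<epsilon>) * integral {x i..x i + h} ?\<phi>"
    proof -
      have "integral {x i..x i + h} (\<lambda>t. f t * g t)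
          = integral {x i..x i + h} (\<lambda>t. \<epsilon> / real K * (S t * g t) + (1 - \<epsilon>) * ?\<phi> t)"
        by (simp add: f_eq algebra_simps)
      also have "\<dots> = integral {x i..x i + h} (\<lambda>t. \<epsilon> / real K * (S t * g t))
          + integral {x i..x i + h} (\<lambda>t. (1 - \<epsilon>) * ?\<phi> t)"
        by (intro integral_add integrable_on_mult_right int)
      finally show ?thesis by (simp only: integral_mult_right)
    qed
    moreover have "integral {x i..x i + h} (\<lambda>t. S t * g t) = integral {x i - A..x i} ?\<phi>"
      unfolding S_def g_def
      using window_integral_std_normal_density_comb[OF h(1), of "x i" K] by (simp add: h(2))
    ultimately show "h * \<eta> < integral {x i..x i + h} (\<lambda>t. f t * g t)"
      by (simp add: algebra_simps)
  qed

  have "disjoint_family_on (\<lambda>i. {x i - h<..<x i + 2 * h}) {..<n}"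
    unfolding disjoint_family_on_def
  proof (intro ballI impI)
    \<comment> \<open>Since \<open>x\<close> advances by \<open>3 * h\<close>, neighbouring windows
      share only an endpoint, which the open intervals omit.\<close>
    have *: "x i + 2 * h \<le> x j - h" if "i < j" for i j
    proof -
      have "(3 * real n + 3 * real i + 3) * h \<le> (3 * real n + 3 * real j) * h"
        using that h(1) by (intro mult_right_mono) auto
      thus ?thesis by (simp add: x_def algebra_simps)
    qed
    fix i j :: nat assume "i \<noteq> j"
    thus "{x i - h<..<x i + 2 * h} \<inter> {x j - h<..<x j + 2 * h} = {}"
      using *[of i j] *[of j i] by (cases "i < j") auto
  qed
  from max_modes_ge[OF adm _ this] mode show ?thesis by (simp add: f_def)
qed

section \<open>The quadratic bound for all positive \<open>A\<close>\<close>

theorem proposition2: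
  shows "\<exists>c::real. c > 0 \<and> (\<forall>A::real. A > 0 \<longrightarrow> ereal (c * A\<^sup>2) \<le> ereal_of_enat (max_modes A))"
proof -
  \<comment> \<open>The right side has the slowest Gaussian decay, and the cubic factor cannot
    compensate.\<close>
  have "eventually (\<lambda>A::real. sqrt 2 * exp (- A\<^sup>2 / 36) + 2 * A ^ 3 * exp (- A\<^sup>2 / 18)
          < exp (- A\<^sup>2 / 72)) at_top"
    by real_asymp
  then obtain B where B: "\<And>A::real. A \<ge> B \<Longrightarrow>
      sqrt 2 * exp (- A\<^sup>2 / 36) + 2 * A ^ 3 * exp (- A\<^sup>2 / 18) < exp (- A\<^sup>2 / 72)"
    by (auto simp: eventually_at_top_linorder)
  \<comment> \<open>The value 30 ensures \<open>C\<^sup>2 \<ge> 900 > 864 = 2 * 432\<close>. Beyond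
    \<open>C\<close>, rounding \<open>A\<^sup>2 / 432\<close> down then loses at most half, so
    \<open>n \<ge> A\<^sup>2 / 864\<close>, while \<open>c = 1 / C\<^sup>2\<close> is below
    \<open>1 / 864\<close>. Up to \<open>C\<close>, \<open>c * A\<^sup>2 \<le> 1\<close> and one
    mode is enough.\<close>
  define C where "C = max B 30"
  have C: "C \<ge> 30" "C \<ge> B" by (auto simp: C_def)
  define c where "c = 1 / C\<^sup>2"
  have "c > 0" using C by (simp add: c_def)
  moreover have "ereal (c * A\<^sup>2) \<le> ereal_of_enat (max_modes A)" if "A > 0" for A
  proof (cases "A \<le> C")
    case True
    have "A\<^sup>2 \<le> C\<^sup>2" using True that by (intro power_mono) auto
    hence "c * A\<^sup>2 \<le> 1" using C by (simp add: c_def)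
    hence "ereal (c * A\<^sup>2) \<le> ereal_of_enat 1" by (simp add: one_enat_def)
    also have "\<dots> \<le> ereal_of_enat (max_modes A)"
      using max_modes_ge_1[OF that] by (simp only: ereal_of_enat_le_iff)
    finally show ?thesis .
  next
    case False
    define n where "n = nat \<lfloor>A\<^sup>2 / 432\<rfloor>"
    have "30\<^sup>2 \<le> A\<^sup>2" "30\<^sup>2 \<le> C\<^sup>2" using False C by (intro power_mono; simp)+
    hence n: "real n \<le> A\<^sup>2 / 432" "A\<^sup>2 / 432 < real n + 1" "n > 0" by (auto simp: n_def) linarith+
    hence "enat n \<le> max_modes A"
      using False C B[of A] by (intro max_modes_ge_of_large) auto
    hence "ereal_of_enat (enat n) \<le> ereal_of_enat (max_modes A)"
      by (simp only: ereal_of_enat_le_iff)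
    moreover have "c * A\<^sup>2 \<le> 1 / 864 * A\<^sup>2"
      unfolding c_def using \<open>30\<^sup>2 \<le> C\<^sup>2\<close> by (intro mult_right_mono divide_left_mono) auto
    hence "c * A\<^sup>2 \<le> real n" using n by linarith
    ultimately show ?thesis by (metis ereal_less_eq(3) ereal_of_enat_simps(1) order_trans)
  qed
  ultimately show ?thesis by blast
qed

end
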